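(* Let $(A,\mathfrak{m})$ be a Noetherian local ring with $\operatorname{depth} A\geq 2$. Let $I$ be an $\mathfrak{m}$-primary Ratliff-Rush closed ideal and assume that $\operatorname{depth} G_{I^n}(A)\geq 2$ for all $n\gg 0$. If $x$ is $A$-superficial with respect to $I$, then $I/(x)$ is a Ratliff-Rush closed ideal of $A/(x)$.
   Context: For an ideal $J$ of a ring $B$, $\widetilde{J} = \bigcup_{j\geq 0}(J^{j+1}:_B J^j)$; $J$ is Ratliff-Rush closed if $\widetilde{J}=J$. An element $x\in I$ is $A$-superficial with respect to $I$ if there is $c\geq 0$ such that $(I^{n+1}:_A x)\cap I^c = I^n$ for all $n\geq c$. For an ideal $J \subseteq \mathfrak m$ of $A$, $G_J(A) = \bigoplus_{n\geq 0} J^n/J^{n+1}$ and $\operatorname{depth} G_J(A)$ is the grade of its graded maximal ideal $\mathfrak{m}/J\oplus\bigoplus_{n\geq 1}J^n/J^{n+1}$ on $G_J(A)$. *)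

theory Defs
  imports "HOL-Algebra.Ring_Divisibility" "HOL-Algebra.Ideal_Product" "HOL-Library.Extended_Nat"
begin

definition local_ring :: "('a, 'b) ring_scheme \<Rightarrow> 'a set \<Rightarrow> bool" where
  "local_ring R M \<longleftrightarrow> cring R \<and> maximalideal M R \<and> (\<forall>N. maximalideal N R \<longrightarrow> N = M)"

text \<open>Powers of an ideal are powers in the multiplicative monoid of ideals; in particular
  the power with exponent \<open>0\<close> is the whole ring.\<close>

abbreviation ideal_pow :: "('a, 'b) ring_scheme \<Rightarrow> 'a set \<Rightarrow> nat \<Rightarrow> 'a set" where
  "ideal_pow R J n \<equiv> J [^]\<^bsub>ideals_set R\<^esub> n"

definition colon :: "('a, 'b) ring_scheme \<Rightarrow> 'a set \<Rightarrow> 'a set \<Rightarrow> 'a set" where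
  "colon R K L = {a \<in> carrier R. \<forall>l\<in>L. a \<otimes>\<^bsub>R\<^esub> l \<in> K}"

definition ideal_radical :: "('a, 'b) ring_scheme \<Rightarrow> 'a set \<Rightarrow> 'a set" where
  "ideal_radical R J = {a \<in> carrier R. \<exists>n::nat. a [^]\<^bsub>R\<^esub> n \<in> J}"

definition primary_ideal :: "('a, 'b) ring_scheme \<Rightarrow> 'a set \<Rightarrow> bool" where
  "primary_ideal R Q \<longleftrightarrow> ideal Q R \<and> Q \<noteq> carrier R \<and>
    (\<forall>a\<in>carrier R. \<forall>b\<in>carrier R. a \<otimes>\<^bsub>R\<^esub> b \<in> Q \<longrightarrow> a \<in> Q \<or> b \<in> ideal_radical R Q)"

definition primary_to :: "('a, 'b) ring_scheme \<Rightarrow> 'a set \<Rightarrow> 'a set \<Rightarrow> bool" where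
  "primary_to R P Q \<longleftrightarrow> primary_ideal R Q \<and> ideal_radical R Q = P"

definition ratliff_rush_closure :: "('a, 'b) ring_scheme \<Rightarrow> 'a set \<Rightarrow> 'a set" where
  "ratliff_rush_closure R J = (\<Union>j. colon R (ideal_pow R J (Suc j)) (ideal_pow R J j))"

definition ratliff_rush_closed :: "('a, 'b) ring_scheme \<Rightarrow> 'a set \<Rightarrow> bool" where
  "ratliff_rush_closed R J \<longleftrightarrow> ideal J R \<and> ratliff_rush_closure R J = J"

definition superficial :: "('a, 'b) ring_scheme \<Rightarrow> 'a set \<Rightarrow> 'a \<Rightarrow> bool" where
  "superficial R I x \<longleftrightarrow> x \<in> I \<and>
    (\<exists>c. \<forall>n\<ge>c. colon R (ideal_pow R I (Suc n)) {x} \<inter> ideal_pow R I c = ideal_pow R I n)"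

definition nonzerodivisor :: "('a, 'b) ring_scheme \<Rightarrow> 'a \<Rightarrow> bool" where
  "nonzerodivisor R x \<longleftrightarrow>
    x \<in> carrier R \<and> (\<forall>y\<in>carrier R. x \<otimes>\<^bsub>R\<^esub> y = \<zero>\<^bsub>R\<^esub> \<longrightarrow> y = \<zero>\<^bsub>R\<^esub>)"

definition regular_sequence :: "('a, 'b) ring_scheme \<Rightarrow> 'a list \<Rightarrow> bool" where
  "regular_sequence R xs \<longleftrightarrow> set xs \<subseteq> carrier R \<and>
    (\<forall>i<length xs. let K = Idl\<^bsub>R\<^esub> (set (take i xs)) in
       nonzerodivisor (R Quot K) (K +>\<^bsub>R\<^esub> (xs ! i))) \<and>
    Idl\<^bsub>R\<^esub> (set xs) \<noteq> carrier R"

definition grade :: "('a, 'b) ring_scheme \<Rightarrow> 'a set \<Rightarrow> enat" where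
  "grade R J = (SUP xs \<in> {xs. set xs \<subseteq> J \<and> regular_sequence R xs}. enat (length xs))"

text \<open>The subset \<open>L/K\<close> of \<open>R/K\<close>.\<close>

definition quotient_image :: "('a, 'b) ring_scheme \<Rightarrow> 'a set \<Rightarrow> 'a set \<Rightarrow> 'a set set" where
  "quotient_image R L K = (\<lambda>a. K +>\<^bsub>R\<^esub> a) ` L"

text \<open>An element of the associated graded ring is the family of its homogeneous components,
  the \<open>n\<close>-th one being a coset of \<open>J\<^sup>n\<^sup>+\<^sup>1\<close> inside \<open>J\<^sup>n\<close>. For \<open>f i = J\<^sup>i\<^sup>+\<^sup>1 + a\<close> with
  \<open>a \<in> J\<^sup>i\<close> and \<open>g j = J\<^sup>j\<^sup>+\<^sup>1 + b\<close> with \<open>b \<in> J\<^sup>j\<close>, where \<open>i + j = n\<close>, the set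
  \<open>rcoset_mult R (J\<^sup>n\<^sup>+\<^sup>1) (f i) (g j)\<close> is the single coset \<open>J\<^sup>n\<^sup>+\<^sup>1 + a b\<close>.\<close>

definition assoc_graded :: "('a, 'b) ring_scheme \<Rightarrow> 'a set \<Rightarrow> (nat \<Rightarrow> 'a set) ring" where
  "assoc_graded R J =
    \<lparr>carrier = {f. (\<forall>n. f n \<in> quotient_image R (ideal_pow R J n) (ideal_pow R J (Suc n))) \<and>
                   finite {n. f n \<noteq> ideal_pow R J (Suc n)}},
     mult = (\<lambda>f g n. \<Oplus>\<^bsub>R Quot ideal_pow R J (Suc n)\<^esub> i \<in> {..n}.
                       rcoset_mult R (ideal_pow R J (Suc n)) (f i) (g (n - i))),
     one = (\<lambda>n. if n = 0 then ideal_pow R J 1 +>\<^bsub>R\<^esub> \<one>\<^bsub>R\<^esub> else ideal_pow R J (Suc n)),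
     zero = (\<lambda>n. ideal_pow R J (Suc n)),
     add = (\<lambda>f g n. f n <+>\<^bsub>R\<^esub> g n)\<rparr>"

text \<open>For \<open>J \<subseteq> M\<close>, the ideal \<open>M/J \<oplus> J/J\<^sup>2 \<oplus> J\<^sup>2/J\<^sup>3 \<oplus> \<dots>\<close> of the associated graded ring.\<close>

definition graded_maximal_ideal :: "('a, 'b) ring_scheme \<Rightarrow> 'a set \<Rightarrow> 'a set \<Rightarrow> (nat \<Rightarrow> 'a set) set" where
  "graded_maximal_ideal R M J = {f \<in> carrier (assoc_graded R J). f 0 \<in> quotient_image R M J}"

text \<open>The maximal ideal is passed explicitly to both depths.\<close>

definition local_depth :: "('a, 'b) ring_scheme \<Rightarrow> 'a set \<Rightarrow> enat" where
  "local_depth R M = grade R M"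

definition assoc_graded_depth :: "('a, 'b) ring_scheme \<Rightarrow> 'a set \<Rightarrow> 'a set \<Rightarrow> enat" where
  "assoc_graded_depth R M J = grade (assoc_graded R J) (graded_maximal_ideal R M J)"

end

theory Submission
  imports Defs "HOL-Algebra.Subrings" "HOL-Algebra.UnivPoly"
begin

text \<open>Since \<open>x \<in> I\<close>, the claim lifts to \<open>A\<close>: if \<open>a I\<^sup>j \<subseteq> I\<^sup>j\<^sup>+\<^sup>1 + (x)\<close>, then \<open>a \<in> I\<close>
  (\<open>ratliff_rush_closed_quotientI\<close>). As \<open>I\<close> is Ratliff-Rush closed, it is enough to get rid of the
  summand \<open>(x)\<close>, that is, to find a single \<open>r\<close> with \<open>a I\<^sup>r \<subseteq> I\<^sup>r\<^sup>+\<^sup>1\<close>.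

  Superficiality turns the hypothesis on \<open>a\<close> into a sharper one: for large \<open>m\<close> each \<open>p \<in> I\<^sup>m\<^sup>+\<^sup>1\<close>
  satisfies \<open>a p \<equiv> x t\<close> modulo \<open>I\<^sup>m\<^sup>+\<^sup>2\<close> with \<open>t \<in> I\<^sup>m\<close>, and \<open>t\<close> is unique modulo \<open>I\<^sup>m\<^sup>+\<^sup>1\<close>
  (\<open>superficial_refined_quotient\<close>). The obstruction to removing \<open>x\<close> is therefore the map \<open>p \<mapsto> t\<close>.
  For \<open>K = I\<^sup>r\<close> with \<open>r\<close> large it induces a linear map of degree \<open>-1\<close> on the part of positive
  degree of \<open>G = G\<^sub>K(A)\<close>.

  If \<open>G\<close> has depth at least two, then suitable powers of a regular sequence lie in the positive
  part of \<open>G\<close>, because the elements of the maximal ideal are nilpotent modulo \<open>K\<close>. A linear map from an ideal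
  containing a regular sequence of length two to the ring is multiplication by an element \<open>e\<close>
  (\<open>linear_graph_is_scalar\<close>). Elements of \<open>G\<close> have no components of negative degree, so a map of
  degree \<open>-1\<close> of this kind is zero. In degree one this reads \<open>t \<in> K\<close> for every \<open>p \<in> K\<close>, and hence
  \<open>a p \<in> I\<^sup>r\<^sup>+\<^sup>1\<close> (\<open>regular_pair_removes_superficial_correction\<close>).

  Elements of \<open>G\<close> are handled through lifts to the Rees ring, realised inside the polynomial
  ring; this also yields the ring axioms for \<open>G\<close>.\<close>

section \<open>Powers of an ideal\<close>

(* This rule would unfold every \<open>J\<^sup>n\<^sup>+\<^sup>1\<close> into a product of ideals. *)
declare Group.nat_pow_Suc [simp del]

context cring
begin

lemma ideals_set_one [simp]: "\<one>\<^bsub>ideals_set R\<^esub> = carrier R"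
  by (simp add: ideals_set_def)

lemma ideal_pow_Suc: "ideal_pow R J (Suc n) = ideal_pow R J n \<cdot> J"
  by (simp add: ideals_set_def Group.nat_pow_Suc)

lemma ideal_pow_ideal:
  assumes "ideal J R"
  shows "ideal (ideal_pow R J n) R"
  using monoid.nat_pow_closed[OF comm_monoid.axioms(1)[OF ideals_set_is_comm_monoid], of J n] assms
  by (simp add: ideals_set_def)

lemma ideal_pow_add:
  assumes "ideal J R"
  shows "ideal_pow R J (m + n) = ideal_pow R J m \<cdot> ideal_pow R J n"
  using monoid.nat_pow_mult[OF comm_monoid.axioms(1)[OF ideals_set_is_comm_monoid], of J m n] assms
  by (simp add: ideals_set_def)

lemma ideal_pow_ideal_pow:
  assumes "ideal J R"
  shows "ideal_pow R (ideal_pow R J m) n = ideal_pow R J (m * n)"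
  using monoid.nat_pow_pow[OF comm_monoid.axioms(1)[OF ideals_set_is_comm_monoid], of J m n] assms
  by (simp add: ideals_set_def)

lemma ideal_pow_1:
  assumes "ideal J R"
  shows "ideal_pow R J (Suc 0) = J"
  using monoid.nat_pow_eone[OF comm_monoid.axioms(1)[OF ideals_set_is_comm_monoid], of J] assms
  by (simp add: ideals_set_def)

lemma ideal_pow_mult:
  assumes "ideal J R" "a \<in> ideal_pow R J m" "b \<in> ideal_pow R J n"
  shows "a \<otimes> b \<in> ideal_pow R J (m + n)"
  using ideal_prod.prod[OF assms(2,3)] ideal_pow_add[OF assms(1)] by simp

lemma ideal_pow_antimono:
  assumes "ideal J R" "m \<le> n"
  shows "ideal_pow R J n \<subseteq> ideal_pow R J m"
proof -
  have "ideal_pow R J (m + (n - m)) \<subseteq> ideal_pow R J m"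
    using ideal_prod_inter[OF ideal_pow_ideal ideal_pow_ideal, OF assms(1,1)] ideal_pow_add[OF assms(1)]
    by simp
  with assms(2) show ?thesis by simp
qed

lemma ideal_pow_carr:
  assumes "ideal J R" "a \<in> ideal_pow R J n"
  shows "a \<in> carrier R"
  using ideal.Icarr[OF ideal_pow_ideal] assms by blast

lemma elem_pow_in_ideal_pow:
  assumes "ideal J R" "a \<in> J"
  shows "a [^] n \<in> ideal_pow R J n"
  using assms(2) by (induct n) (auto simp: ideal_pow_Suc intro: ideal_prod.prod)

lemma ideal_finsum_closed:
  assumes "ideal L R" "\<And>i. i \<in> S \<Longrightarrow> F i \<in> L"
  shows "(\<Oplus>i\<in>S. F i) \<in> L"
proof -
  interpret L: ideal L R by fact
  show ?thesis
    using assms(2)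
  proof (induct S rule: infinite_finite_induct)
    case (insert i S)
    then have "F \<in> S \<rightarrow> carrier R" "F i \<in> carrier R" using L.Icarr by auto
    with insert show ?case by (simp add: L.a_closed)
  qed simp_all
qed

text \<open>The coefficients \<open>a\<close> and \<open>x\<close> stand outside the sums because the two sums will be components of
  products in the associated graded ring.\<close>

lemma finsum_congruence:
  assumes "ideal L R" "a \<in> carrier R" "x \<in> carrier R" "finite S"
    and "\<And>i. i \<in> S \<Longrightarrow> F i \<in> carrier R" "\<And>i. i \<in> S \<Longrightarrow> G i \<in> carrier R"
    and "\<And>i. i \<in> S \<Longrightarrow> a \<otimes> F i \<ominus> x \<otimes> G i \<in> L"
  shows "a \<otimes> (\<Oplus>i\<in>S. F i) \<ominus> x \<otimes> (\<Oplus>i\<in>S. G i) \<in> L"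
proof -
  interpret L: ideal L R by fact
  show ?thesis
    using assms(4-)
  proof (induct S rule: finite_induct)
    case empty
    then show ?case using assms(2,3) by (simp add: minus_eq)
  next
    case (insert i S)
    have F: "F \<in> S \<rightarrow> carrier R" "F i \<in> carrier R" and G: "G \<in> S \<rightarrow> carrier R" "G i \<in> carrier R"
      using insert by auto
    have Fs: "finsum R F S \<in> carrier R" and Gs: "finsum R G S \<in> carrier R"
      using F G by auto
    have "a \<otimes> (F i \<oplus> finsum R F S) \<ominus> x \<otimes> (G i \<oplus> finsum R G S)
        = (a \<otimes> F i \<ominus> x \<otimes> G i) \<oplus> (a \<otimes> finsum R F S \<ominus> x \<otimes> finsum R G S)"
      using Fs Gs F(2) G(2) assms(2,3) by algebra
    then show ?case using insert F G by (simp add: L.a_closed)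
  qed
qed

end

section \<open>Regular pairs\<close>

text \<open>A regular sequence of length two, with regularity modulo the first element spelled out
  in the ring itself.\<close>

definition regular_pair :: "('a, 'b) ring_scheme \<Rightarrow> 'a \<Rightarrow> 'a \<Rightarrow> bool" where
  "regular_pair R f g \<longleftrightarrow> f \<in> carrier R \<and> g \<in> carrier R \<and>
    (\<forall>y\<in>carrier R. f \<otimes>\<^bsub>R\<^esub> y = \<zero>\<^bsub>R\<^esub> \<longrightarrow> y = \<zero>\<^bsub>R\<^esub>) \<and>
    (\<forall>y\<in>carrier R. \<forall>z\<in>carrier R. g \<otimes>\<^bsub>R\<^esub> y = f \<otimes>\<^bsub>R\<^esub> z \<longrightarrow> (\<exists>z'\<in>carrier R. y = f \<otimes>\<^bsub>R\<^esub> z'))"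

context cring
begin

lemma nonzerodivisor_quotient_iff:
  assumes "ideal K R" "g \<in> carrier R"
  shows "nonzerodivisor (R Quot K) (K +> g) \<longleftrightarrow> (\<forall>y\<in>carrier R. g \<otimes> y \<in> K \<longrightarrow> y \<in> K)"
proof -
  interpret K: ideal K R by fact
  have "(K +> y = K) \<longleftrightarrow> y \<in> K" if "y \<in> carrier R" for y
    using that K.a_rcos_const K.a_rcos_self by blast
  then show ?thesis
    using assms(2)
    by (auto simp: nonzerodivisor_def FactRing_simps K.rcoset_mult_add)
qed

lemma regular_pair_of_grade:
  assumes "grade R M \<ge> 2"
  shows "\<exists>f\<in>M. \<exists>g\<in>M. regular_pair R f g"
proof -
  have "\<not> (\<forall>xs\<in>{xs. set xs \<subseteq> M \<and> regular_sequence R xs}. enat (length xs) \<le> 1)"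
  proof
    assume "\<forall>xs\<in>{xs. set xs \<subseteq> M \<and> regular_sequence R xs}. enat (length xs) \<le> 1"
    then have "grade R M \<le> 1" unfolding grade_def by (intro SUP_least) blast
    with assms have "(2::enat) \<le> 1" by (rule order_trans)
    then show False by simp
  qed
  then obtain xs where xs: "set xs \<subseteq> M" "regular_sequence R xs" "\<not> enat (length xs) \<le> 1"
    by blast
  then have len: "2 \<le> length xs" by (simp add: one_enat_def)
  then obtain f g ys where fg: "xs = f # g # ys"
    by (metis One_nat_def Suc_1 Suc_le_length_iff)
  have carr: "f \<in> carrier R" "g \<in> carrier R"
    using xs(2) fg by (auto simp: regular_sequence_def)
  have "\<forall>i<length xs. nonzerodivisor (R Quot Idl (set (take i xs))) (Idl (set (take i xs)) +> (xs ! i))"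
    using xs(2) by (simp add: regular_sequence_def Let_def)
  from this[rule_format, of 0] this[rule_format, of 1]
  have nz: "nonzerodivisor (R Quot Idl {}) (Idl {} +> f)" "nonzerodivisor (R Quot Idl {f}) (Idl {f} +> g)"
    by (simp_all add: fg)
  have "Idl {} = {\<zero>}"
    using genideal_minimal[OF zeroideal, of "{}"] genideal_ideal[of "{}"]
      additive_subgroup.zero_closed[OF ideal.axioms(1)] by blast
  then have f: "\<forall>y\<in>carrier R. f \<otimes> y = \<zero> \<longrightarrow> y = \<zero>"
    using nz(1) nonzerodivisor_quotient_iff[OF zeroideal carr(1)] by simp
  have "\<forall>y\<in>carrier R. g \<otimes> y \<in> PIdl f \<longrightarrow> y \<in> PIdl f"
    using nz(2) nonzerodivisor_quotient_iff[OF cgenideal_ideal carr(2), of f] carr(1)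
    by (simp add: cgenideal_eq_genideal)
  then have "\<forall>y\<in>carrier R. \<forall>z\<in>carrier R. g \<otimes> y = f \<otimes> z \<longrightarrow> (\<exists>z'\<in>carrier R. y = f \<otimes> z')"
    unfolding cgenideal_def using m_comm[OF carr(1)] by force
  with f carr xs(1) fg show ?thesis by (auto simp: regular_pair_def)
qed

text \<open>Passing to powers moves a regular pair into any ideal that contains powers of both elements.\<close>

lemma regular_pair_pow:
  assumes "regular_pair R f g"
  shows "regular_pair R (f [^] (s::nat)) (g [^] (t::nat))"
proof -
  have f: "f \<in> carrier R" and g: "g \<in> carrier R"
    and freg: "\<And>y. y \<in> carrier R \<Longrightarrow> f \<otimes> y = \<zero> \<Longrightarrow> y = \<zero>"
    and greg: "\<And>y z. y \<in> carrier R \<Longrightarrow> z \<in> carrier R \<Longrightarrow> g \<otimes> y = f \<otimes> z \<Longrightarrow> \<exists>z'\<in>carrier R. y = f \<otimes> z'"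
    using assms by (auto simp: regular_pair_def)
  have cancel: "y = z" if "y \<in> carrier R" "z \<in> carrier R" "f \<otimes> y = f \<otimes> z" for y z
  proof -
    have "f \<otimes> (y \<ominus> z) = f \<otimes> y \<ominus> f \<otimes> z" using that(1,2) f by algebra
    then have "f \<otimes> (y \<ominus> z) = \<zero>" using that f by simp
    then have "y \<ominus> z = \<zero>" using freg that by simp
    then show ?thesis using that by simp
  qed
  have fs: "y = \<zero>" if "y \<in> carrier R" "f [^] s \<otimes> y = \<zero>" for y
    using that
  proof (induct s)
    case (Suc s)
    have "f \<otimes> (f [^] s \<otimes> y) = \<zero>" using Suc.prems f by (simp add: m_ac)
    then show ?case using freg[of "f [^] s \<otimes> y"] Suc f by simp
  qed simp
  have gs: "\<exists>z'\<in>carrier R. y = f [^] s \<otimes> z'"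
    if "y \<in> carrier R" "z \<in> carrier R" "g \<otimes> y = f [^] s \<otimes> z" for y z
    using that
  proof (induct s arbitrary: y z)
    case 0
    then show ?case by auto
  next
    case (Suc s)
    have "g \<otimes> y = f \<otimes> (f [^] s \<otimes> z)" using Suc.prems f by (simp add: m_ac)
    then obtain y' where y': "y' \<in> carrier R" "y = f \<otimes> y'"
      using greg[of y "f [^] s \<otimes> z"] Suc.prems f by auto
    have "f \<otimes> (g \<otimes> y') = f \<otimes> (f [^] s \<otimes> z)"
      using Suc.prems y' f g by (simp add: m_ac)
    then have "g \<otimes> y' = f [^] s \<otimes> z" by (rule cancel[rotated 2]) (use y'(1) f g Suc.prems(2) in simp_all)
    then obtain z' where "z' \<in> carrier R" "y' = f [^] s \<otimes> z'"
      using Suc.hyps[OF y'(1)] Suc.prems by blast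
    then show ?case using y' f by (intro bexI[of _ z']) (auto simp: m_ac)
  qed
  have "\<exists>z'\<in>carrier R. y = f [^] s \<otimes> z'"
    if "y \<in> carrier R" "z \<in> carrier R" "g [^] t \<otimes> y = f [^] s \<otimes> z" for y z
    using that
  proof (induct t arbitrary: z)
    case 0
    then show ?case by auto
  next
    case (Suc t)
    have "g \<otimes> (g [^] t \<otimes> y) = f [^] s \<otimes> z" using Suc.prems g by (simp add: m_ac)
    then obtain z' where "z' \<in> carrier R" "g [^] t \<otimes> y = f [^] s \<otimes> z'"
      using gs[of "g [^] t \<otimes> y" z] Suc.prems g by auto
    then show ?case using Suc.hyps Suc.prems by blast
  qed
  with fs f g show ?thesis by (auto simp: regular_pair_def)
qed

text \<open>This is the elementary content of the vanishing of \<open>Ext\<^sup>1(R/D, R)\<close> for an ideal \<open>D\<close> of grade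
  at least two: every linear map \<open>D \<rightarrow> R\<close> is multiplication by a scalar. The values \<open>u\<close> at
  \<open>f\<close> and \<open>v\<close> at \<open>g\<close> satisfy \<open>g u = f v\<close>, so regularity of \<open>g\<close> modulo \<open>f\<close> gives \<open>u = f e\<close>, and then
  \<open>e\<close> works for all arguments since \<open>f\<close> can be cancelled. The map enters
  through its graph \<open>\<Phi>\<close>, the form in which division by a superficial element produces it.\<close>

lemma linear_graph_is_scalar:
  assumes reg: "regular_pair R f g"
    and carr: "\<And>h w. \<Phi> h w \<Longrightarrow> h \<in> carrier R \<and> w \<in> carrier R"
    and mult: "\<And>h w u. \<Phi> h w \<Longrightarrow> u \<in> carrier R \<Longrightarrow> \<Phi> (u \<otimes> h) (u \<otimes> w)"
    and uniq: "\<And>h w w'. \<Phi> h w \<Longrightarrow> \<Phi> h w' \<Longrightarrow> w = w'"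
    and "\<Phi> f u" "\<Phi> g v"
  shows "\<exists>e\<in>carrier R. \<forall>h w. \<Phi> h w \<longrightarrow> w = h \<otimes> e"
proof -
  have c: "f \<in> carrier R" "g \<in> carrier R" "u \<in> carrier R" "v \<in> carrier R"
    using carr assms(5,6) by auto
  have "\<Phi> (g \<otimes> f) (g \<otimes> u)" "\<Phi> (g \<otimes> f) (f \<otimes> v)"
    using mult[OF assms(5) c(2)] mult[OF assms(6) c(1)] c by (simp_all add: m_comm)
  then have "g \<otimes> u = f \<otimes> v" by (rule uniq)
  then obtain e where e: "e \<in> carrier R" "u = f \<otimes> e"
    using reg c by (auto simp: regular_pair_def)
  have "w = h \<otimes> e" if hw: "\<Phi> h w" for h w
  proof -
    have hc: "h \<in> carrier R" "w \<in> carrier R" using carr hw by auto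
    have "\<Phi> (h \<otimes> f) (f \<otimes> w)" "\<Phi> (h \<otimes> f) (h \<otimes> u)"
      using mult[OF hw c(1)] mult[OF assms(5) hc(1)] hc c by (simp_all add: m_comm)
    then have "f \<otimes> w = h \<otimes> u" by (rule uniq)
    then have "f \<otimes> (w \<ominus> h \<otimes> e) = h \<otimes> u \<ominus> h \<otimes> u"
      using e c hc by algebra
    then have "f \<otimes> (w \<ominus> h \<otimes> e) = \<zero>" using hc c by simp
    then have "w \<ominus> h \<otimes> e = \<zero>" using reg hc e by (simp add: regular_pair_def)
    then show ?thesis using hc e by simp
  qed
  with e show ?thesis by blast
qed

end

section \<open>The associated graded ring as a quotient of the Rees ring\<close>

text \<open>Multiplication of polynomials is the Cauchy product by which the associated graded ring
  multiplies, so homogeneous components can be compared without regrading.\<close>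

definition rees :: "('a, 'b) ring_scheme \<Rightarrow> 'a set \<Rightarrow> (nat \<Rightarrow> 'a) set" where
  "rees R J = {p \<in> up R. \<forall>n. p n \<in> ideal_pow R J n}"

definition graded_class :: "('a, 'b) ring_scheme \<Rightarrow> 'a set \<Rightarrow> (nat \<Rightarrow> 'a) \<Rightarrow> nat \<Rightarrow> 'a set" where
  "graded_class R J p = (\<lambda>n. ideal_pow R J (Suc n) +>\<^bsub>R\<^esub> p n)"

lemma cring_surjective_image:
  assumes "cring R" "h \<in> ring_hom R S" "h ` carrier R = carrier S" "h \<zero>\<^bsub>R\<^esub> = \<zero>\<^bsub>S\<^esub>"
  shows "cring S"
proof -
  interpret R: cring R by fact
  note hom = ring_hom_closed[OF assms(2)] ring_hom_mult[OF assms(2), symmetric]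
    ring_hom_add[OF assms(2), symmetric] ring_hom_one[OF assms(2), symmetric] assms(4)[symmetric]
  have all: "(\<forall>y\<in>carrier S. Q y) \<longleftrightarrow> (\<forall>a\<in>carrier R. Q (h a))" for Q
    unfolding assms(3)[symmetric] by simp
  have ex: "(\<exists>y\<in>carrier S. Q y) \<longleftrightarrow> (\<exists>a\<in>carrier R. Q (h a))" for Q
    unfolding assms(3)[symmetric] by simp
  have add: "abelian_group S"
  proof (rule abelian_groupI)
    have "h (\<ominus>\<^bsub>R\<^esub> a) \<oplus>\<^bsub>S\<^esub> h a = \<zero>\<^bsub>S\<^esub>" if "a \<in> carrier R" for a
      using that by (simp add: hom R.l_neg)
    then have "\<forall>a\<in>carrier S. \<exists>b\<in>carrier S. b \<oplus>\<^bsub>S\<^esub> a = \<zero>\<^bsub>S\<^esub>"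
      unfolding all ex using R.a_inv_closed by blast
    then show "\<exists>b\<in>carrier S. b \<oplus>\<^bsub>S\<^esub> a = \<zero>\<^bsub>S\<^esub>" if "a \<in> carrier S" for a
      using that by blast
    have "\<forall>a\<in>carrier S. \<forall>b\<in>carrier S. \<forall>c\<in>carrier S. a \<oplus>\<^bsub>S\<^esub> b \<oplus>\<^bsub>S\<^esub> c = a \<oplus>\<^bsub>S\<^esub> (b \<oplus>\<^bsub>S\<^esub> c)"
      unfolding all by (simp add: hom R.a_assoc)
    then show "a \<oplus>\<^bsub>S\<^esub> b \<oplus>\<^bsub>S\<^esub> c = a \<oplus>\<^bsub>S\<^esub> (b \<oplus>\<^bsub>S\<^esub> c)"
      if "a \<in> carrier S" "b \<in> carrier S" "c \<in> carrier S" for a b c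
      using that by blast
    have "\<forall>a\<in>carrier S. \<forall>b\<in>carrier S. a \<oplus>\<^bsub>S\<^esub> b = b \<oplus>\<^bsub>S\<^esub> a"
      unfolding all by (simp add: hom R.a_comm)
    then show "a \<oplus>\<^bsub>S\<^esub> b = b \<oplus>\<^bsub>S\<^esub> a" if "a \<in> carrier S" "b \<in> carrier S" for a b
      using that by blast
    have "\<forall>a\<in>carrier S. \<forall>b\<in>carrier S. a \<oplus>\<^bsub>S\<^esub> b \<in> carrier S"
      unfolding all by (simp add: hom)
    then show "a \<oplus>\<^bsub>S\<^esub> b \<in> carrier S" if "a \<in> carrier S" "b \<in> carrier S" for a b
      using that by blast
    have "\<forall>a\<in>carrier S. \<zero>\<^bsub>S\<^esub> \<oplus>\<^bsub>S\<^esub> a = a"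
      unfolding all by (simp add: hom)
    then show "\<zero>\<^bsub>S\<^esub> \<oplus>\<^bsub>S\<^esub> a = a" if "a \<in> carrier S" for a
      using that by blast
    show "\<zero>\<^bsub>S\<^esub> \<in> carrier S" by (simp add: hom)
  qed
  have mult: "comm_monoid S"
  proof (rule comm_monoidI)
    have "\<forall>a\<in>carrier S. \<forall>b\<in>carrier S. \<forall>c\<in>carrier S. a \<otimes>\<^bsub>S\<^esub> b \<otimes>\<^bsub>S\<^esub> c = a \<otimes>\<^bsub>S\<^esub> (b \<otimes>\<^bsub>S\<^esub> c)"
      unfolding all by (simp add: hom R.m_assoc)
    then show "a \<otimes>\<^bsub>S\<^esub> b \<otimes>\<^bsub>S\<^esub> c = a \<otimes>\<^bsub>S\<^esub> (b \<otimes>\<^bsub>S\<^esub> c)"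
      if "a \<in> carrier S" "b \<in> carrier S" "c \<in> carrier S" for a b c
      using that by blast
    have "\<forall>a\<in>carrier S. \<forall>b\<in>carrier S. a \<otimes>\<^bsub>S\<^esub> b = b \<otimes>\<^bsub>S\<^esub> a"
      unfolding all by (simp add: hom R.m_comm)
    then show "a \<otimes>\<^bsub>S\<^esub> b = b \<otimes>\<^bsub>S\<^esub> a" if "a \<in> carrier S" "b \<in> carrier S" for a b
      using that by blast
    have "\<forall>a\<in>carrier S. \<forall>b\<in>carrier S. a \<otimes>\<^bsub>S\<^esub> b \<in> carrier S"
      unfolding all by (simp add: hom)
    then show "a \<otimes>\<^bsub>S\<^esub> b \<in> carrier S" if "a \<in> carrier S" "b \<in> carrier S" for a b
      using that by blast
    have "\<forall>a\<in>carrier S. \<one>\<^bsub>S\<^esub> \<otimes>\<^bsub>S\<^esub> a = a"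
      unfolding all by (simp add: hom)
    then show "\<one>\<^bsub>S\<^esub> \<otimes>\<^bsub>S\<^esub> a = a" if "a \<in> carrier S" for a
      using that by blast
    show "\<one>\<^bsub>S\<^esub> \<in> carrier S" by (simp add: hom)
  qed
  have "\<forall>a\<in>carrier S. \<forall>b\<in>carrier S. \<forall>c\<in>carrier S.
      (a \<oplus>\<^bsub>S\<^esub> b) \<otimes>\<^bsub>S\<^esub> c = a \<otimes>\<^bsub>S\<^esub> c \<oplus>\<^bsub>S\<^esub> b \<otimes>\<^bsub>S\<^esub> c"
    unfolding all using R.l_distr by (simp add: hom)
  then show ?thesis by (intro cringI[OF add mult]) blast
qed

context cring
begin

lemma carrier_UP: "carrier (UP R) = up R"
  by (simp add: UP_def)

lemma coeff_UP: "p \<in> up R \<Longrightarrow> coeff (UP R) p n = p n"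
  by (simp add: UP_def)

lemma up_mult_apply:
  assumes "p \<in> up R" "q \<in> up R"
  shows "(p \<otimes>\<^bsub>UP R\<^esub> q) n = (\<Oplus>i\<in>{..n}. p i \<otimes> q (n - i))"
  using assms by (simp add: UP_def)

text \<open>This subring is the Rees ring \<open>R[J t]\<close>.\<close>

lemma rees_subcring:
  assumes "ideal J R"
  shows "subcring (rees R J) (UP R)"
proof -
  interpret P: UP_cring R "UP R" by unfold_locales simp
  have cP: "cring (UP R)" by (rule P.UP_cring)
  have id: "ideal (ideal_pow R J n) R" for n by (rule ideal_pow_ideal[OF assms])
  note sub = additive_subgroup.zero_closed[OF ideal.axioms(1)[OF id]]
    additive_subgroup.a_closed[OF ideal.axioms(1)[OF id]]
    additive_subgroup.a_inv_closed[OF ideal.axioms(1)[OF id]]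
  show ?thesis
  proof (intro cring.subcringI'[OF cP] ring.subringI[OF cring.axioms(1)[OF cP]])
    show "rees R J \<subseteq> carrier (UP R)" by (auto simp: rees_def UP_def)
    show "\<one>\<^bsub>UP R\<^esub> \<in> rees R J"
      using sub(1) up_one_closed by (auto simp: rees_def UP_def)
    fix p assume p: "p \<in> rees R J"
    then have up: "p \<in> up R" by (simp add: rees_def)
    have up': "\<ominus>\<^bsub>UP R\<^esub> p \<in> up R"
      using P.UP_a_inv_closed[of p] up unfolding carrier_UP by blast
    have "coeff (UP R) (\<ominus>\<^bsub>UP R\<^esub> p) n = \<ominus> (coeff (UP R) p n)" for n
      using P.coeff_a_inv[of p] up unfolding carrier_UP by blast
    then have "(\<ominus>\<^bsub>UP R\<^esub> p) n = \<ominus> (p n)" for n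
      unfolding coeff_UP[OF up] coeff_UP[OF up'] .
    then show "\<ominus>\<^bsub>UP R\<^esub> p \<in> rees R J"
      using p up' sub(3) unfolding rees_def by simp
  next
    fix p q assume p: "p \<in> rees R J" and q: "q \<in> rees R J"
    have "p i \<otimes> q (n - i) \<in> ideal_pow R J n" if "i \<in> {..n}" for i n
      using ideal_pow_mult[OF assms, of "p i" i "q (n - i)" "n - i"] p q that
      by (simp add: rees_def)
    then have "(\<Oplus>i\<in>{..n}. p i \<otimes> q (n - i)) \<in> ideal_pow R J n" for n
      by (rule ideal_finsum_closed[OF id])
    then show "p \<otimes>\<^bsub>UP R\<^esub> q \<in> rees R J"
      using p q up_mult_closed by (simp add: rees_def UP_def)
    show "p \<oplus>\<^bsub>UP R\<^esub> q \<in> rees R J"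
      using p q sub(2) up_add_closed by (simp add: rees_def UP_def)
  qed
qed

lemma rees_mult_closed:
  assumes "ideal J R" "p \<in> rees R J" "q \<in> rees R J"
  shows "p \<otimes>\<^bsub>UP R\<^esub> q \<in> rees R J"
  using subcringE(6)[OF rees_subcring] assms by blast

lemma rees_carr:
  assumes "p \<in> rees R J"
  shows "p n \<in> carrier R"
  using assms by (auto simp: rees_def)

text \<open>The factors are cosets of \<open>J\<^sup>i\<^sup>+\<^sup>1\<close> and \<open>J\<^sup>j\<^sup>+\<^sup>1\<close>, not of \<open>J\<^sup>i\<^sup>+\<^sup>j\<^sup>+\<^sup>1\<close>; that their
  product is nevertheless a single coset of \<open>J\<^sup>i\<^sup>+\<^sup>j\<^sup>+\<^sup>1\<close> uses that the representatives lie in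
  \<open>J\<^sup>i\<close> and \<open>J\<^sup>j\<close>.\<close>

lemma rcoset_mult_homogeneous:
  assumes "ideal J R" "a \<in> ideal_pow R J i" "b \<in> ideal_pow R J j"
  shows "rcoset_mult R (ideal_pow R J (Suc (i + j))) (ideal_pow R J (Suc i) +> a) (ideal_pow R J (Suc j) +> b)
    = ideal_pow R J (Suc (i + j)) +> a \<otimes> b"
proof -
  let ?K = "ideal_pow R J (Suc (i + j))"
  have idK: "ideal ?K R" by (rule ideal_pow_ideal[OF assms(1)])
  interpret K: ideal ?K R by (rule idK)
  note carr = ideal_pow_carr[OF assms(1)]
  have ac: "a \<in> carrier R" "b \<in> carrier R" using assms carr by blast+
  have const: "?K +> a' \<otimes> b' = ?K +> a \<otimes> b"
    if mem: "a' \<in> ideal_pow R J (Suc i) +> a" "b' \<in> ideal_pow R J (Suc j) +> b" for a' b'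
  proof -
    obtain k l where k: "k \<in> ideal_pow R J (Suc i)" "a' = k \<oplus> a"
      and l: "l \<in> ideal_pow R J (Suc j)" "b' = l \<oplus> b"
      using mem unfolding a_r_coset_def' by blast
    have kl: "k \<in> carrier R" "l \<in> carrier R" using k l carr by blast+
    have "l \<in> ideal_pow R J j"
      using l ideal_pow_antimono[OF assms(1), of j "Suc j"] by auto
    then have "k \<otimes> l \<in> ?K" "k \<otimes> b \<in> ?K" "a \<otimes> l \<in> ?K"
      using ideal_pow_mult[OF assms(1) k(1), of l j] ideal_pow_mult[OF assms(1) k(1) assms(3)]
        ideal_pow_mult[OF assms(1,2) l(1)] by simp_all
    then have "k \<otimes> l \<oplus> k \<otimes> b \<oplus> a \<otimes> l \<in> ?K" by (simp add: K.a_closed)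
    moreover have "a' \<otimes> b' \<ominus> a \<otimes> b = k \<otimes> l \<oplus> k \<otimes> b \<oplus> a \<otimes> l"
      unfolding k(2) l(2) using kl ac by algebra
    ultimately have "a' \<otimes> b' \<ominus> a \<otimes> b \<in> ?K" by simp
    moreover have "a' \<otimes> b' \<in> carrier R" "a \<otimes> b \<in> carrier R" using k l kl ac by simp_all
    ultimately show ?thesis using quotient_eq_iff_same_a_r_cos[OF idK] by blast
  qed
  have "a \<in> ideal_pow R J (Suc i) +> a" "b \<in> ideal_pow R J (Suc j) +> b"
    using abelian_subgroup.a_rcos_self[OF abelian_subgroupI3[OF ideal.axioms(1)[OF ideal_pow_ideal[OF assms(1)]]
      is_abelian_group]] ac by blast+
  with const show ?thesis unfolding rcoset_mult_def by blast
qed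

lemma graded_class_hom:
  assumes "ideal J R"
  shows "graded_class R J \<in> ring_hom (UP R\<lparr>carrier := rees R J\<rparr>) (assoc_graded R J)"
    and "graded_class R J ` rees R J = carrier (assoc_graded R J)"
    and "graded_class R J \<zero>\<^bsub>UP R\<^esub> = \<zero>\<^bsub>assoc_graded R J\<^esub>"
proof -
  have id: "ideal (ideal_pow R J n) R" for n by (rule ideal_pow_ideal[OF assms])
  have zero: "ideal_pow R J n +> \<zero> = ideal_pow R J n" for n
    using a_coset_add_zero additive_subgroup.a_subset[OF ideal.axioms(1)[OF id]] by blast
  have closed: "graded_class R J p \<in> carrier (assoc_graded R J)" if p: "p \<in> rees R J" for p
  proof -
    obtain N where "bound \<zero> N p" using p by (auto simp: rees_def)
    then have "graded_class R J p n = ideal_pow R J (Suc n)" if "N < n" for n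
      using zero that by (simp add: graded_class_def bound.bound)
    then have "{n. graded_class R J p n \<noteq> ideal_pow R J (Suc n)} \<subseteq> {..N}"
      using not_less by blast
    then have "finite {n. graded_class R J p n \<noteq> ideal_pow R J (Suc n)}"
      by (rule finite_subset) simp
    then show ?thesis
      using p by (simp add: assoc_graded_def graded_class_def quotient_image_def rees_def)
  qed
  show "graded_class R J ` rees R J = carrier (assoc_graded R J)"
  proof (intro equalityI subsetI)
    fix f assume f: "f \<in> carrier (assoc_graded R J)"
    have "\<exists>a\<in>ideal_pow R J n. ideal_pow R J (Suc n) +> a = f n \<and>
        (f n = ideal_pow R J (Suc n) \<longrightarrow> a = \<zero>)" for n
    proof (cases "f n = ideal_pow R J (Suc n)")
      case True
      then show ?thesis
        using zero additive_subgroup.zero_closed[OF ideal.axioms(1)[OF id]] by blast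
    next
      case False
      moreover have "f n \<in> (\<lambda>a. ideal_pow R J (Suc n) +> a) ` ideal_pow R J n"
        using f by (simp add: assoc_graded_def quotient_image_def)
      ultimately show ?thesis by (metis imageE)
    qed
    then obtain p where p: "\<And>n. p n \<in> ideal_pow R J n"
      "\<And>n. ideal_pow R J (Suc n) +> p n = f n" "\<And>n. f n = ideal_pow R J (Suc n) \<Longrightarrow> p n = \<zero>"
      by metis
    have "finite {n. f n \<noteq> ideal_pow R J (Suc n)}" using f by (simp add: assoc_graded_def)
    then obtain N where "\<forall>n\<in>{n. f n \<noteq> ideal_pow R J (Suc n)}. n \<le> N"
      using finite_nat_set_iff_bounded_le by blast
    then have "bound \<zero> N p" using p(3) by (force simp: bound_def)
    then have "p \<in> up R" using ideal_pow_carr[OF assms p(1)] by blast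
    then have "p \<in> rees R J" using p(1) by (simp add: rees_def)
    moreover have "graded_class R J p = f" using p(2) by (auto simp: graded_class_def)
    ultimately show "f \<in> graded_class R J ` rees R J" by blast
  qed (use closed in auto)
  show "graded_class R J \<zero>\<^bsub>UP R\<^esub> = \<zero>\<^bsub>assoc_graded R J\<^esub>"
    by (simp add: graded_class_def assoc_graded_def UP_def zero)
  show "graded_class R J \<in> ring_hom (UP R\<lparr>carrier := rees R J\<rparr>) (assoc_graded R J)"
  proof (rule ring_hom_memI)
    fix p q assume "p \<in> carrier (UP R\<lparr>carrier := rees R J\<rparr>)" "q \<in> carrier (UP R\<lparr>carrier := rees R J\<rparr>)"
    then have p: "p \<in> rees R J" and q: "q \<in> rees R J" by simp_all
    have up: "p \<in> up R" "q \<in> up R" using p q by (simp_all add: rees_def)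
    have carr: "p n \<in> carrier R" "q n \<in> carrier R" for n by (rule mem_upD[OF up(1)], rule mem_upD[OF up(2)])
    have "graded_class R J (p \<otimes>\<^bsub>UP R\<^esub> q) n = (graded_class R J p \<otimes>\<^bsub>assoc_graded R J\<^esub> graded_class R J q) n" for n
    proof -
      let ?K = "ideal_pow R J (Suc n)"
      interpret K: ideal ?K R by (rule id)
      interpret h: ring_hom_cring R "R Quot ?K" "(+>) ?K" by (rule K.rcos_ring_hom_cring) (rule is_cring)
      have prod: "rcoset_mult R ?K (graded_class R J p i) (graded_class R J q (n - i)) = ?K +> p i \<otimes> q (n - i)"
        if "i \<in> {..n}" for i
        using rcoset_mult_homogeneous[OF assms, of "p i" i "q (n - i)" "n - i"] p q that
        by (simp add: graded_class_def rees_def)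
      have "(graded_class R J p \<otimes>\<^bsub>assoc_graded R J\<^esub> graded_class R J q) n
          = (\<Oplus>\<^bsub>R Quot ?K\<^esub> i \<in> {..n}. rcoset_mult R ?K (graded_class R J p i) (graded_class R J q (n - i)))"
        by (simp add: assoc_graded_def)
      also have "\<dots> = (\<Oplus>\<^bsub>R Quot ?K\<^esub> i \<in> {..n}. ?K +> p i \<otimes> q (n - i))"
      proof (rule h.S.finsum_cong'[OF refl])
        show "(\<lambda>i. ?K +> p i \<otimes> q (n - i)) \<in> {..n} \<rightarrow> carrier (R Quot ?K)"
          using h.hom_closed[OF m_closed[OF carr]] by blast
      qed (rule prod)
      also have "\<dots> = ?K +> (\<Oplus>i\<in>{..n}. p i \<otimes> q (n - i))"
        using h.hom_finsum[of "\<lambda>i. p i \<otimes> q (n - i)" "{..n}"] carr by (simp add: comp_def Pi_def)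
      finally show ?thesis using up_mult_apply[OF up] by (simp add: graded_class_def)
    qed
    then show "graded_class R J (p \<otimes>\<^bsub>UP R\<lparr>carrier := rees R J\<rparr>\<^esub> q)
        = graded_class R J p \<otimes>\<^bsub>assoc_graded R J\<^esub> graded_class R J q"
      by auto
    have "(ideal_pow R J (Suc n) +> p n) <+> (ideal_pow R J (Suc n) +> q n)
        = ideal_pow R J (Suc n) +> (p n \<oplus> q n)" for n
      using ideal.a_rcos_sum[OF id carr] .
    then show "graded_class R J (p \<oplus>\<^bsub>UP R\<lparr>carrier := rees R J\<rparr>\<^esub> q)
        = graded_class R J p \<oplus>\<^bsub>assoc_graded R J\<^esub> graded_class R J q"
      using up by (simp add: graded_class_def assoc_graded_def UP_def)
  next
    show "graded_class R J \<one>\<^bsub>UP R\<lparr>carrier := rees R J\<rparr>\<^esub> = \<one>\<^bsub>assoc_graded R J\<^esub>"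
      using zero by (simp add: graded_class_def assoc_graded_def UP_def fun_eq_iff)
  qed (use closed in simp)
qed

lemma assoc_graded_cring:
  assumes "ideal J R"
  shows "cring (assoc_graded R J)"
proof (rule cring_surjective_image)
  interpret P: UP_cring R "UP R" by unfold_locales simp
  show "cring (UP R\<lparr>carrier := rees R J\<rparr>)"
    using ring.subcring_iff[OF cring.axioms(1)[OF P.UP_cring]] rees_subcring[OF assms]
      subcringE(1)[OF rees_subcring[OF assms]] by blast
  show "graded_class R J \<in> ring_hom (UP R\<lparr>carrier := rees R J\<rparr>) (assoc_graded R J)"
    by (rule graded_class_hom(1)[OF assms])
qed (simp_all add: graded_class_hom(2,3)[OF assms])

lemma graded_class_mult:
  assumes "ideal J R" "p \<in> rees R J" "q \<in> rees R J"
  shows "graded_class R J (p \<otimes>\<^bsub>UP R\<^esub> q) = graded_class R J p \<otimes>\<^bsub>assoc_graded R J\<^esub> graded_class R J q"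
  using ring_hom_mult[OF graded_class_hom(1)[OF assms(1)], of p q] assms(2,3) by simp

lemma graded_class_eq_iff:
  assumes "ideal J R" "p \<in> rees R J" "q \<in> rees R J"
  shows "graded_class R J p = graded_class R J q \<longleftrightarrow> (\<forall>n. p n \<ominus> q n \<in> ideal_pow R J (Suc n))"
  using quotient_eq_iff_same_a_r_cos[OF ideal_pow_ideal[OF assms(1)]]
    rees_carr[OF assms(2)] rees_carr[OF assms(3)]
  by (simp add: graded_class_def fun_eq_iff)

lemma graded_class_lift:
  assumes "ideal J R" "f \<in> carrier (assoc_graded R J)"
  obtains p where "p \<in> rees R J" "f = graded_class R J p"
  using assms graded_class_hom(2)[OF assms(1)] by blast

lemma graded_class_pow:
  assumes "ideal J R" "p \<in> rees R J"
  shows "\<exists>q\<in>rees R J. graded_class R J p [^]\<^bsub>assoc_graded R J\<^esub> (s::nat) = graded_class R J q \<and> q 0 = p 0 [^] s"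
proof (induct s)
  case 0
  have "\<one>\<^bsub>UP R\<^esub> \<in> rees R J" using subcringE(3)[OF rees_subcring[OF assms(1)]] .
  moreover have "graded_class R J \<one>\<^bsub>UP R\<^esub> = \<one>\<^bsub>assoc_graded R J\<^esub>"
    using ring_hom_one[OF graded_class_hom(1)[OF assms(1)]] by simp
  moreover have "\<one>\<^bsub>UP R\<^esub> 0 = \<one>" by (simp add: UP_def)
  ultimately show ?case by (intro bexI[of _ "\<one>\<^bsub>UP R\<^esub>"]) auto
next
  case (Suc s)
  then obtain q where q: "q \<in> rees R J" "q 0 = p 0 [^] s"
    "graded_class R J p [^]\<^bsub>assoc_graded R J\<^esub> s = graded_class R J q" by blast
  have up: "p \<in> up R" "q \<in> up R" using assms q by (simp_all add: rees_def)
  have "(q \<otimes>\<^bsub>UP R\<^esub> p) 0 = q 0 \<otimes> p 0" using mem_upD[OF up(1)] mem_upD[OF up(2)] by (simp add: up_mult_apply up)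
  then show ?case
    using q assms rees_mult_closed[OF assms(1) q(1) assms(2)] graded_class_mult[OF assms(1) q(1) assms(2)]
    by (intro bexI[of _ "q \<otimes>\<^bsub>UP R\<^esub> p"]) (auto simp: Group.nat_pow_Suc)
qed

text \<open>Taking the component of degree zero is multiplicative, so nilpotency of the elements of \<open>M\<close>
  modulo \<open>J\<close> kills that component in some power.\<close>

lemma graded_maximal_ideal_pow:
  assumes "ideal J R" "ideal M R" "J \<subseteq> M" "\<And>b. b \<in> M \<Longrightarrow> \<exists>s::nat. b [^] s \<in> J"
    and "f \<in> graded_maximal_ideal R M J"
  shows "\<exists>s::nat. (f [^]\<^bsub>assoc_graded R J\<^esub> s) 0 = J"
proof -
  have f: "f \<in> carrier (assoc_graded R J)" and "f 0 \<in> quotient_image R M J"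
    using assms(5) by (simp_all add: graded_maximal_ideal_def)
  then obtain b where b: "b \<in> M" "f 0 = J +> b" by (auto simp: quotient_image_def)
  obtain p where p: "p \<in> rees R J" "f = graded_class R J p" using graded_class_lift[OF assms(1) f] .
  have c: "p 0 \<in> carrier R" "b \<in> carrier R"
    using rees_carr[OF p(1)] ideal.Icarr[OF assms(2) b(1)] by auto
  have "J +> p 0 = J +> b" using b(2) p(2) ideal_pow_1[OF assms(1)] by (simp add: graded_class_def)
  then have "p 0 \<ominus> b \<in> M" using quotient_eq_iff_same_a_r_cos[OF assms(1) c] assms(3) by auto
  then have "(p 0 \<ominus> b) \<oplus> b \<in> M"
    using b(1) additive_subgroup.a_closed[OF ideal.axioms(1)[OF assms(2)]] by blast
  moreover have "(p 0 \<ominus> b) \<oplus> b = p 0" using c by algebra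
  ultimately obtain s :: nat where s: "p 0 [^] s \<in> J" using assms(4) by fastforce
  obtain q where "f [^]\<^bsub>assoc_graded R J\<^esub> s = graded_class R J q" "q 0 = p 0 [^] s"
    using graded_class_pow[OF assms(1) p(1), of s] p(2) by blast
  then have "(f [^]\<^bsub>assoc_graded R J\<^esub> s) 0 = J +> (p 0 [^] s)"
    using ideal_pow_1[OF assms(1)] by (simp add: graded_class_def)
  also have "\<dots> = J" using ideal.rcos_const_imp_mem s
    by (simp add: abelian_subgroup.a_rcos_const abelian_subgroupI3[OF ideal.axioms(1)[OF assms(1)] is_abelian_group])
  finally show ?thesis by blast
qed

end

section \<open>Elements multiplying a power of an ideal into the next one modulo a superficial element\<close>

context cring
begin

text \<open>Superficiality controls \<open>x t\<close> only for \<open>t \<in> I\<^sup>c\<close>. The coefficients \<open>t\<close> in the hypothesis are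
  arbitrary, but after multiplication by elements of \<open>I\<^sup>c\<close> they do lie in \<open>I\<^sup>c\<close>, at the
  cost of \<open>c\<close> in the exponent. As \<open>x t\<close> then lies in \<open>I\<^sup>m\<^sup>+\<^sup>1\<close> together with \<open>a p\<close>, it follows that \<open>t \<in> I\<^sup>m\<close>.\<close>

lemma superficial_refined_quotient:
  assumes I: "ideal I R" and x: "x \<in> carrier R" and a: "a \<in> carrier R"
    and sup: "\<forall>n\<ge>c. colon R (ideal_pow R I (Suc n)) {x} \<inter> ideal_pow R I c = ideal_pow R I n"
    and mult: "\<forall>l\<in>ideal_pow R I j. \<exists>u\<in>ideal_pow R I (Suc j). \<exists>t\<in>carrier R. a \<otimes> l = u \<oplus> x \<otimes> t"
    and m: "j + c \<le> m" and p: "p \<in> ideal_pow R I (Suc m)"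
  shows "\<exists>t\<in>ideal_pow R I m. a \<otimes> p \<ominus> x \<otimes> t \<in> ideal_pow R I (Suc (Suc m))"
proof -
  note carr = ideal_pow_carr[OF I]
  have id: "ideal (ideal_pow R I n) R" for n by (rule ideal_pow_ideal[OF I])
  note add = additive_subgroup.a_closed[OF ideal.axioms(1)[OF id]]
  have "p \<in> ideal_pow R I j \<cdot> ideal_pow R I (Suc m - j)"
    using p m ideal_pow_add[OF I, of j "Suc m - j"] by simp
  then have "\<exists>u\<in>ideal_pow R I (Suc (Suc m)). \<exists>t\<in>ideal_pow R I c. a \<otimes> p = u \<oplus> x \<otimes> t"
  proof (induct p rule: ideal_prod.induct)
    case (prod l y)
    obtain u t where u: "u \<in> ideal_pow R I (Suc j)" and t: "t \<in> carrier R" and eq: "a \<otimes> l = u \<oplus> x \<otimes> t"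
      using mult prod(1) by blast
    have "Suc j + (Suc m - j) = Suc (Suc m)" using m by simp
    then have uy: "u \<otimes> y \<in> ideal_pow R I (Suc (Suc m))"
      using ideal_pow_mult[OF I u prod(2)] by metis
    have "c \<le> Suc m - j" using m by simp
    then have "y \<in> ideal_pow R I c" using prod(2) ideal_pow_antimono[OF I] by blast
    then have ty: "t \<otimes> y \<in> ideal_pow R I c" using ideal.I_l_closed[OF id] t by blast
    have "a \<otimes> (l \<otimes> y) = (a \<otimes> l) \<otimes> y" using a carr[OF prod(1)] carr[OF prod(2)] by (simp add: m_assoc)
    also have "\<dots> = u \<otimes> y \<oplus> x \<otimes> (t \<otimes> y)"
      unfolding eq using carr[OF u] t x carr[OF prod(2)] by algebra
    finally show ?case using uy ty by blast
  next
    case (sum p1 p2)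
    have pc: "p1 \<in> carrier R" "p2 \<in> carrier R"
      using sum(1,3) ideal_prod_in_carrier[OF id id] by blast+
    obtain u1 t1 where 1: "u1 \<in> ideal_pow R I (Suc (Suc m))" "t1 \<in> ideal_pow R I c" "a \<otimes> p1 = u1 \<oplus> x \<otimes> t1"
      using sum(2) by blast
    obtain u2 t2 where 2: "u2 \<in> ideal_pow R I (Suc (Suc m))" "t2 \<in> ideal_pow R I c" "a \<otimes> p2 = u2 \<oplus> x \<otimes> t2"
      using sum(4) by blast
    have "a \<otimes> (p1 \<oplus> p2) = a \<otimes> p1 \<oplus> a \<otimes> p2" using a pc by algebra
    also have "\<dots> = (u1 \<oplus> u2) \<oplus> x \<otimes> (t1 \<oplus> t2)"
      unfolding 1(3) 2(3) using carr[OF 1(1)] carr[OF 1(2)] carr[OF 2(1)] carr[OF 2(2)] x by algebra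
    finally show ?case using add[OF 1(1) 2(1)] add[OF 1(2) 2(2)] by blast
  qed
  then obtain u t where u: "u \<in> ideal_pow R I (Suc (Suc m))" and t: "t \<in> ideal_pow R I c"
    and eq: "a \<otimes> p = u \<oplus> x \<otimes> t"
    by blast
  have c: "u \<in> carrier R" "t \<in> carrier R" "p \<in> carrier R" using carr u t p by blast+
  have "a \<otimes> p \<in> ideal_pow R I (Suc m)" using ideal.I_l_closed[OF id p a] .
  moreover have "\<ominus> u \<in> ideal_pow R I (Suc m)"
    using u ideal_pow_antimono[OF I, of "Suc m" "Suc (Suc m)"]
      additive_subgroup.a_inv_closed[OF ideal.axioms(1)[OF id]] by auto
  ultimately have "\<ominus> u \<oplus> a \<otimes> p \<in> ideal_pow R I (Suc m)" by (rule add[rotated])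
  moreover have "\<ominus> u \<oplus> a \<otimes> p = t \<otimes> x" unfolding eq using c x by algebra
  ultimately have "t \<in> colon R (ideal_pow R I (Suc m)) {x}" using c by (simp add: colon_def)
  moreover have "c \<le> m" using m by simp
  ultimately have "t \<in> ideal_pow R I m" using t sup by blast
  moreover have "a \<otimes> p \<ominus> x \<otimes> t = u" unfolding eq using c x by algebra
  ultimately show ?thesis using u by auto
qed

text \<open>With \<open>K = I\<^sup>r\<close>, division of \<open>a p\<close> by \<open>x\<close> modulo higher powers of \<open>I\<close> is a linear map of degree
  \<open>-1\<close> from the part of positive degree of the associated graded ring of \<open>K\<close> to that ring. A regular
  pair forces it to be multiplication by some element \<open>e\<close>; since nothing of degree \<open>-1\<close>
  exists, the map vanishes. Its vanishing on degree one says that \<open>a K\<close> lies in \<open>I\<^sup>r\<^sup>+\<^sup>1\<close>, with no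
  correction by multiples of \<open>x\<close>.\<close>

lemma regular_pair_removes_superficial_correction:
  fixes I :: "'a set" and r :: nat
  defines "K \<equiv> ideal_pow R I r"
  defines "G \<equiv> assoc_graded R K"
  assumes I: "ideal I R" and xI: "x \<in> I" and a: "a \<in> carrier R"
    and sup: "\<forall>n\<ge>c. colon R (ideal_pow R I (Suc n)) {x} \<inter> ideal_pow R I c = ideal_pow R I n"
    and mult: "\<forall>l\<in>ideal_pow R I j. \<exists>u\<in>ideal_pow R I (Suc j). \<exists>t\<in>carrier R. a \<otimes> l = u \<oplus> x \<otimes> t"
    and r: "j + c < r"
    and reg: "regular_pair G f g" and f0: "f 0 = K" and g0: "g 0 = K"
    and p: "p \<in> ideal_pow R I r"
  shows "a \<otimes> p \<in> ideal_pow R I (Suc r)"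
proof -
  note carr = ideal_pow_carr[OF I]
  have id: "ideal (ideal_pow R I n) R" for n by (rule ideal_pow_ideal[OF I])
  have idK: "ideal K R" unfolding K_def by (rule id)
  have Kpow: "ideal_pow R K n = ideal_pow R I (r * n)" for n
    unfolding K_def by (rule ideal_pow_ideal_pow[OF I])
  have x: "x \<in> carrier R" using ideal.Icarr[OF I xI] .
  interpret G: cring G unfolding G_def by (rule assoc_graded_cring[OF idK])
  note add = additive_subgroup.a_closed[OF ideal.axioms(1)[OF id]]
  note inv = additive_subgroup.a_inv_closed[OF ideal.axioms(1)[OF id]]

  (* Here \<open>q\<^sub>n\<close> is a quotient of \<open>a p\<^sub>n\<^sub>+\<^sub>1\<close> by \<open>x\<close>. The remainder is measured in powers of \<open>I\<close>:
     cancelling \<open>x\<close> loses one power of \<open>I\<close>, which leaves \<open>I\<^bsup>r(n+1)\<^esup> = K\<^sup>n\<^sup>+\<^sup>1\<close>, exactly the precision at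
     which the component of degree \<open>n\<close> is defined. The condition \<open>q\<^sub>n \<in> I\<^sup>c\<close> matters for \<open>n = 0\<close>,
     where \<open>K\<^sup>n\<close> is the whole ring and superficiality would not apply. *)
  define lifts where "lifts = (\<lambda>p q. p \<in> rees R K \<and> q \<in> rees R K \<and> p 0 = \<zero> \<and>
    (\<forall>n. q n \<in> ideal_pow R I c \<and> a \<otimes> p (Suc n) \<ominus> x \<otimes> q n \<in> ideal_pow R I (Suc (r * Suc n))))"
  define \<Phi> where "\<Phi> = (\<lambda>h w. \<exists>p q. lifts p q \<and> h = graded_class R K p \<and> w = graded_class R K q)"

  have rees_in: "s n \<in> ideal_pow R I (r * n)" if "s \<in> rees R K" for s n
    using that by (simp add: rees_def Kpow)

  have carrier: "h \<in> carrier G \<and> w \<in> carrier G" if "\<Phi> h w" for h w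
    using that graded_class_hom(2)[OF idK] unfolding \<Phi>_def lifts_def G_def by blast

  have scale: "\<Phi> (u \<otimes>\<^bsub>G\<^esub> h) (u \<otimes>\<^bsub>G\<^esub> w)" if hw: "\<Phi> h w" and u: "u \<in> carrier G" for h w u
  proof -
    obtain p q where pq: "p \<in> rees R K" "q \<in> rees R K" "p 0 = \<zero>" "\<And>n. q n \<in> ideal_pow R I c"
      "\<And>n. a \<otimes> p (Suc n) \<ominus> x \<otimes> q n \<in> ideal_pow R I (Suc (r * Suc n))"
      and hw_eq: "h = graded_class R K p" "w = graded_class R K q"
      using hw unfolding \<Phi>_def lifts_def by blast
    obtain s where s: "s \<in> rees R K" "u = graded_class R K s"
      using graded_class_lift[OF idK] u unfolding G_def by blast
    have up: "s \<in> up R" "p \<in> up R" "q \<in> up R" using s pq by (simp_all add: rees_def)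
    note sc = rees_carr[OF s(1)] and pc = rees_carr[OF pq(1)] and qc = rees_carr[OF pq(2)]
    have "(s \<otimes>\<^bsub>UP R\<^esub> p) 0 = \<zero>" using up_mult_apply[OF up(1,2)] sc pq(3) by simp
    moreover have "(s \<otimes>\<^bsub>UP R\<^esub> q) n \<in> ideal_pow R I c" for n
      unfolding up_mult_apply[OF up(1,3)]
      by (rule ideal_finsum_closed[OF id]) (rule ideal.I_l_closed[OF id pq(4) sc])
    moreover have "a \<otimes> (s \<otimes>\<^bsub>UP R\<^esub> p) (Suc n) \<ominus> x \<otimes> (s \<otimes>\<^bsub>UP R\<^esub> q) n \<in> ideal_pow R I (Suc (r * Suc n))" for n
    proof -
      (* The top summand drops out because \<open>p\<close> has no constant term. *)
      have "(\<Oplus>i\<in>{..Suc n}. s i \<otimes> p (Suc n - i)) = (\<Oplus>i\<in>{..n}. s i \<otimes> p (Suc n - i))"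
        using sc pc pq(3) by (simp add: Pi_def)
      moreover have "a \<otimes> (\<Oplus>i\<in>{..n}. s i \<otimes> p (Suc n - i)) \<ominus> x \<otimes> (\<Oplus>i\<in>{..n}. s i \<otimes> q (n - i))
          \<in> ideal_pow R I (Suc (r * Suc n))"
      proof (rule finsum_congruence[OF id a x])
        fix i assume i: "i \<in> {..n}"
        then have suc: "Suc n - i = Suc (n - i)" by auto
        obtain k where "n = i + k" using i le_Suc_ex by blast
        then have "r * i + Suc (r * Suc (n - i)) = Suc (r * Suc n)" by (simp add: algebra_simps)
        then have "s i \<otimes> (a \<otimes> p (Suc (n - i)) \<ominus> x \<otimes> q (n - i)) \<in> ideal_pow R I (Suc (r * Suc n))"
          using ideal_pow_mult[OF I rees_in[OF s(1), of i] pq(5)[of "n - i"]] by metis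
        moreover have "s i \<otimes> (a \<otimes> p (Suc (n - i)) \<ominus> x \<otimes> q (n - i))
            = a \<otimes> (s i \<otimes> p (Suc n - i)) \<ominus> x \<otimes> (s i \<otimes> q (n - i))"
          unfolding suc using a x sc[of i] pc[of "Suc (n - i)"] qc[of "n - i"] by algebra
        ultimately show "a \<otimes> (s i \<otimes> p (Suc n - i)) \<ominus> x \<otimes> (s i \<otimes> q (n - i)) \<in> ideal_pow R I (Suc (r * Suc n))"
          by simp
      qed (use sc pc qc in auto)
      ultimately show ?thesis unfolding up_mult_apply[OF up(1,2)] up_mult_apply[OF up(1,3)] by simp
    qed
    ultimately have "lifts (s \<otimes>\<^bsub>UP R\<^esub> p) (s \<otimes>\<^bsub>UP R\<^esub> q)"
      unfolding lifts_def using rees_mult_closed[OF idK s(1)] pq(1,2) by blast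
    then show ?thesis
      unfolding \<Phi>_def hw_eq s(2) G_def
      using graded_class_mult[OF idK s(1) pq(1)] graded_class_mult[OF idK s(1) pq(2)] by metis
  qed

  have functional: "w = w'" if hw: "\<Phi> h w" and hw': "\<Phi> h w'" for h w w'
  proof -
    obtain p q where pq: "p \<in> rees R K" "q \<in> rees R K" "\<And>n. q n \<in> ideal_pow R I c"
      "\<And>n. a \<otimes> p (Suc n) \<ominus> x \<otimes> q n \<in> ideal_pow R I (Suc (r * Suc n))"
      and eq: "h = graded_class R K p" "w = graded_class R K q"
      using hw unfolding \<Phi>_def lifts_def by blast
    obtain p' q' where pq': "p' \<in> rees R K" "q' \<in> rees R K" "\<And>n. q' n \<in> ideal_pow R I c"
      "\<And>n. a \<otimes> p' (Suc n) \<ominus> x \<otimes> q' n \<in> ideal_pow R I (Suc (r * Suc n))"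
      and eq': "h = graded_class R K p'" "w' = graded_class R K q'"
      using hw' unfolding \<Phi>_def lifts_def by blast
    have "q n \<ominus> q' n \<in> ideal_pow R K (Suc n)" for n
    proof -
      let ?L = "ideal_pow R I (Suc (r * Suc n))"
      note cs = rees_carr[OF pq(1), of "Suc n"] rees_carr[OF pq(2), of n]
        rees_carr[OF pq'(1), of "Suc n"] rees_carr[OF pq'(2), of n]
      have "p (Suc n) \<ominus> p' (Suc n) \<in> ideal_pow R I (r * Suc (Suc n))"
        using graded_class_eq_iff[OF idK pq(1) pq'(1)] eq(1) eq'(1) unfolding Kpow by metis
      moreover have "Suc (r * Suc n) \<le> r * Suc (Suc n)" using r by simp
      ultimately have "p (Suc n) \<ominus> p' (Suc n) \<in> ?L" using ideal_pow_antimono[OF I] by blast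
      then have "a \<otimes> (p (Suc n) \<ominus> p' (Suc n)) \<in> ?L" using ideal.I_l_closed[OF id] a by blast
      then have "a \<otimes> (p (Suc n) \<ominus> p' (Suc n)) \<oplus> (\<ominus> (a \<otimes> p (Suc n) \<ominus> x \<otimes> q n)
          \<oplus> (a \<otimes> p' (Suc n) \<ominus> x \<otimes> q' n)) \<in> ?L"
        by (intro add inv pq(4) pq'(4))
      moreover have "a \<otimes> (p (Suc n) \<ominus> p' (Suc n)) \<oplus> (\<ominus> (a \<otimes> p (Suc n) \<ominus> x \<otimes> q n)
          \<oplus> (a \<otimes> p' (Suc n) \<ominus> x \<otimes> q' n)) = (q n \<ominus> q' n) \<otimes> x"
        using a x cs by algebra
      ultimately have "q n \<ominus> q' n \<in> colon R ?L {x}" using cs by (simp add: colon_def)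
      moreover have "q n \<ominus> q' n \<in> ideal_pow R I c"
        unfolding a_minus_def by (intro add inv pq(3) pq'(3))
      moreover have "c \<le> r * Suc n" using r by simp
      ultimately have "q n \<ominus> q' n \<in> ideal_pow R I (r * Suc n)" using sup by blast
      then show ?thesis unfolding Kpow .
    qed
    then show ?thesis using graded_class_eq_iff[OF idK pq(2) pq'(2)] eq(2) eq'(2) by blast
  qed

  have divide: "\<exists>t\<in>ideal_pow R I (r * n). t \<in> ideal_pow R I c \<and>
      a \<otimes> y \<ominus> x \<otimes> t \<in> ideal_pow R I (Suc (r * Suc n))"
    if y: "y \<in> ideal_pow R I (r * Suc n)" for y n
  proof -
    obtain m where m: "r * Suc n = Suc m" using r by (cases "r * Suc n") auto
    have "j + c \<le> m" "r * n \<le> m" using m r by auto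
    moreover have "\<exists>t\<in>ideal_pow R I m. a \<otimes> y \<ominus> x \<otimes> t \<in> ideal_pow R I (Suc (Suc m))"
      using superficial_refined_quotient[OF I x a sup mult \<open>j + c \<le> m\<close>] y unfolding m .
    ultimately show ?thesis
      using ideal_pow_antimono[OF I, of "r * n" m] ideal_pow_antimono[OF I, of c m] unfolding m by auto
  qed

  have total: "\<exists>w. \<Phi> h w" if h: "h \<in> carrier G" and h0: "h 0 = K" for h
  proof -
    obtain p' where p': "p' \<in> rees R K" "h = graded_class R K p'"
      using graded_class_lift[OF idK] h unfolding G_def by blast
    define p where "p = p'(0 := \<zero>)"
    have zero: "\<zero> \<in> ideal_pow R I n" for n
      by (rule additive_subgroup.zero_closed[OF ideal.axioms(1)[OF id]])
    obtain N where N: "bound \<zero> N p'" using p'(1) by (auto simp: rees_def)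
    then have "bound \<zero> N p" by (auto simp: p_def bound_def)
    moreover have "p n \<in> carrier R" for n using rees_carr[OF p'(1)] by (simp add: p_def)
    ultimately have "p \<in> up R" by blast
    moreover have p_in: "p n \<in> ideal_pow R I (r * n)" for n
      using rees_in[OF p'(1)] by (simp add: p_def)
    ultimately have p: "p \<in> rees R K" by (simp add: rees_def Kpow)
    have "K +> p' 0 = K" using h0 p'(2) ideal_pow_1[OF idK] by (simp add: graded_class_def)
    also have "K = K +> \<zero>"
      using a_coset_add_zero additive_subgroup.a_subset[OF ideal.axioms(1)[OF idK]] by blast
    finally have "graded_class R K p = h"
      unfolding p'(2) graded_class_def p_def by (auto simp: ideal_pow_1[OF idK] fun_eq_iff)
    (* Choosing \<open>0\<close> wherever \<open>p\<close> vanishes keeps the support of \<open>q\<close> finite. *)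
    moreover have "\<exists>t. t \<in> ideal_pow R I (r * n) \<and> t \<in> ideal_pow R I c \<and>
        a \<otimes> p (Suc n) \<ominus> x \<otimes> t \<in> ideal_pow R I (Suc (r * Suc n)) \<and> (p (Suc n) = \<zero> \<longrightarrow> t = \<zero>)" for n
    proof (cases "p (Suc n) = \<zero>")
      case True
      then show ?thesis using zero a x by (intro exI[of _ \<zero>]) (simp add: minus_eq)
    next
      case False
      then show ?thesis using divide[OF p_in[of "Suc n"]] by blast
    qed
    then obtain q where q: "\<And>n. q n \<in> ideal_pow R I (r * n)" "\<And>n. q n \<in> ideal_pow R I c"
      "\<And>n. a \<otimes> p (Suc n) \<ominus> x \<otimes> q n \<in> ideal_pow R I (Suc (r * Suc n))"
      "\<And>n. p (Suc n) = \<zero> \<Longrightarrow> q n = \<zero>"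
      by metis
    have "bound \<zero> N q" using \<open>bound \<zero> N p\<close> q(4) by (auto simp: bound_def)
    then have "q \<in> up R" using carr[OF q(1)] by blast
    then have "q \<in> rees R K" using q(1) by (simp add: rees_def Kpow)
    moreover have "p 0 = \<zero>" by (simp add: p_def)
    ultimately show ?thesis using p q(2,3) unfolding \<Phi>_def lifts_def by blast
  qed

  have fg: "f \<in> carrier G" "g \<in> carrier G" using reg by (simp_all add: regular_pair_def)
  obtain u v where uv: "\<Phi> f u" "\<Phi> g v" using total[OF fg(1) f0] total[OF fg(2) g0] by blast
  have "\<exists>e\<in>carrier G. \<forall>h w. \<Phi> h w \<longrightarrow> w = h \<otimes>\<^bsub>G\<^esub> e"
    by (rule G.linear_graph_is_scalar[where \<Phi> = \<Phi>, OF reg carrier scale functional uv])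
  then obtain e where e: "e \<in> carrier G" "\<And>h w. \<Phi> h w \<Longrightarrow> w = h \<otimes>\<^bsub>G\<^esub> e" by blast
  obtain E where E: "E \<in> rees R K" "e = graded_class R K E"
    using graded_class_lift[OF idK] e(1) unfolding G_def by blast

  define P where "P = (\<lambda>n. if n = Suc 0 then p else \<zero>)"
  have "bound \<zero> 1 P" "\<And>n. P n \<in> carrier R" using carr[OF p] by (auto simp: P_def bound_def)
  then have "P \<in> up R" by blast
  moreover have "\<forall>n. P n \<in> ideal_pow R K n"
    using p additive_subgroup.zero_closed[OF ideal.axioms(1)[OF id]] by (simp add: P_def Kpow)
  ultimately have P: "P \<in> rees R K" by (simp add: rees_def)
  have Kzero: "K +> \<zero> = K"
    using a_coset_add_zero additive_subgroup.a_subset[OF ideal.axioms(1)[OF idK]] by blast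
  have "graded_class R K P 0 = K" by (simp add: graded_class_def P_def ideal_pow_1[OF idK] Kzero)
  moreover have "graded_class R K P \<in> carrier G"
    using graded_class_hom(2)[OF idK] P unfolding G_def by blast
  ultimately obtain w where "\<Phi> (graded_class R K P) w" using total by blast
  then have "\<Phi> (graded_class R K P) (graded_class R K P \<otimes>\<^bsub>G\<^esub> e)" using e(2) by metis
  then obtain P' Q where PQ: "P' \<in> rees R K" "Q \<in> rees R K"
      "a \<otimes> P' (Suc 0) \<ominus> x \<otimes> Q 0 \<in> ideal_pow R I (Suc (r * Suc 0))"
      and PP': "graded_class R K P = graded_class R K P'"
      and Q: "graded_class R K P \<otimes>\<^bsub>G\<^esub> e = graded_class R K Q"
    unfolding \<Phi>_def lifts_def by blast
  (* In degree zero the product with \<open>e\<close> vanishes, so that \<open>x Q\<^sub>0\<close> is absorbed by \<open>I\<^sup>r\<^sup>+\<^sup>1\<close>. *)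
  have "graded_class R K Q = graded_class R K (P \<otimes>\<^bsub>UP R\<^esub> E)"
    using Q graded_class_mult[OF idK P E(1)] unfolding E(2) G_def by simp
  then have "Q 0 \<ominus> (P \<otimes>\<^bsub>UP R\<^esub> E) 0 \<in> K"
    using graded_class_eq_iff[OF idK PQ(2) rees_mult_closed[OF idK P E(1)]] ideal_pow_1[OF idK] by metis
  moreover have "(P \<otimes>\<^bsub>UP R\<^esub> E) 0 = \<zero>"
    using up_mult_apply[of P E 0] P E(1) rees_carr[OF E(1), of 0] by (simp add: rees_def P_def)
  ultimately have "Q 0 \<in> ideal_pow R I r"
    using rees_carr[OF PQ(2), of 0] by (simp add: K_def minus_eq)
  then have xQ: "x \<otimes> Q 0 \<in> ideal_pow R I (Suc r)"
    using ideal_pow_mult[OF I, of x "Suc 0" "Q 0" r] xI ideal_pow_1[OF I] by simp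
  have "P (Suc 0) \<ominus> P' (Suc 0) \<in> ideal_pow R I (r * Suc (Suc 0))"
    using graded_class_eq_iff[OF idK P PQ(1)] PP' unfolding Kpow by blast
  moreover have "Suc r \<le> r * Suc (Suc 0)" using r by simp
  ultimately have "P (Suc 0) \<ominus> P' (Suc 0) \<in> ideal_pow R I (Suc r)"
    using ideal_pow_antimono[OF I] by blast
  then have "p \<ominus> P' (Suc 0) \<in> ideal_pow R I (Suc r)" by (simp add: P_def)
  then have "a \<otimes> (p \<ominus> P' (Suc 0)) \<in> ideal_pow R I (Suc r)"
    using ideal.I_l_closed[OF id] a by blast
  then have "a \<otimes> (p \<ominus> P' (Suc 0)) \<oplus> ((a \<otimes> P' (Suc 0) \<ominus> x \<otimes> Q 0) \<oplus> x \<otimes> Q 0) \<in> ideal_pow R I (Suc r)"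
    using PQ(3) xQ by (intro add) simp_all
  moreover have "a \<otimes> (p \<ominus> P' (Suc 0)) \<oplus> ((a \<otimes> P' (Suc 0) \<ominus> x \<otimes> Q 0) \<oplus> x \<otimes> Q 0) = a \<otimes> p"
    using a x carr[OF p] rees_carr[OF PQ(1), of "Suc 0"] rees_carr[OF PQ(2), of 0] by algebra
  ultimately show ?thesis by simp
qed

end

section \<open>Ratliff-Rush closedness of a quotient by a principal ideal\<close>

lemma image_ideal_prod:
  assumes "ring R" "h \<in> ring_hom R S" "ideal I R" "ideal J R"
  shows "h ` (I \<cdot>\<^bsub>R\<^esub> J) = (h ` I) \<cdot>\<^bsub>S\<^esub> (h ` J)"
proof (intro equalityI subsetI)
  note in_carr = subsetD[OF ring.ideal_prod_in_carrier[OF assms(1,3,4)]]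
  fix y assume "y \<in> h ` (I \<cdot>\<^bsub>R\<^esub> J)"
  then obtain s where "s \<in> I \<cdot>\<^bsub>R\<^esub> J" "y = h s" by blast
  then show "y \<in> (h ` I) \<cdot>\<^bsub>S\<^esub> (h ` J)"
  proof (induct s arbitrary: y rule: ideal_prod.induct)
    case (prod i j)
    then show ?case
      using ring_hom_mult[OF assms(2)] ideal.Icarr[OF assms(3)] ideal.Icarr[OF assms(4)]
      by (simp add: ideal_prod.prod)
  next
    case (sum s1 s2)
    then show ?case
      using ring_hom_add[OF assms(2) in_carr in_carr] by (simp add: ideal_prod.sum)
  qed
next
  note in_carr = subsetD[OF ring.ideal_prod_in_carrier[OF assms(1,3,4)]]
  fix y assume "y \<in> (h ` I) \<cdot>\<^bsub>S\<^esub> (h ` J)"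
  then show "y \<in> h ` (I \<cdot>\<^bsub>R\<^esub> J)"
  proof (induct y rule: ideal_prod.induct)
    case (prod i j)
    then obtain i' j' where "i' \<in> I" "j' \<in> J" "i = h i'" "j = h j'" by blast
    moreover from this have "h (i' \<otimes>\<^bsub>R\<^esub> j') = h i' \<otimes>\<^bsub>S\<^esub> h j'"
      using ring_hom_mult[OF assms(2)] ideal.Icarr[OF assms(3)] ideal.Icarr[OF assms(4)] by blast
    ultimately show ?case using ideal_prod.prod[of i' I j' J R] by (metis imageI)
  next
    case (sum s1 s2)
    then obtain t1 t2 where "t1 \<in> I \<cdot>\<^bsub>R\<^esub> J" "t2 \<in> I \<cdot>\<^bsub>R\<^esub> J" "s1 = h t1" "s2 = h t2" by blast
    then show ?case
      using ring_hom_add[OF assms(2) in_carr in_carr] ideal_prod.sum[of t1 R I J t2] by (metis imageI)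
  qed
qed

context cring
begin

lemma quotient_image_ideal_pow:
  assumes "ideal K R" "ideal J R"
  shows "ideal_pow (R Quot K) (quotient_image R J K) n = quotient_image R (ideal_pow R J n) K"
proof (induct n)
  case 0
  have "carrier (R Quot K) = (+>) K ` carrier R"
    by (auto simp: FactRing_simps)
  then show ?case
    using cring.ideals_set_one[OF ideal.quotient_is_cring[OF assms(1) is_cring]]
    by (simp add: quotient_image_def)
next
  case (Suc n)
  then show ?case
    using image_ideal_prod[OF ring_axioms ideal.rcos_ring_hom[OF assms(1)] ideal_pow_ideal assms(2), OF assms(2)]
      cring.ideal_pow_Suc[OF ideal.quotient_is_cring[OF assms(1) is_cring]]
    by (simp add: quotient_image_def ideal_pow_Suc)
qed

text \<open>Because \<open>x \<in> I\<close>, the ideal \<open>I\<close> is the full preimage of \<open>I/(x)\<close>, so the colon condition may be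
  checked on representatives.\<close>

lemma ratliff_rush_closed_quotientI:
  assumes I: "ideal I R" and xI: "x \<in> I"
    and closed: "\<And>a j. a \<in> carrier R \<Longrightarrow>
      \<forall>l\<in>ideal_pow R I j. \<exists>u\<in>ideal_pow R I (Suc j). \<exists>t\<in>carrier R. a \<otimes> l = u \<oplus> x \<otimes> t \<Longrightarrow> a \<in> I"
  shows "ratliff_rush_closed (R Quot (PIdl x)) (quotient_image R I (PIdl x))"
proof -
  have x: "x \<in> carrier R" using ideal.Icarr[OF I xI] .
  have P: "ideal (PIdl x) R" using cgenideal_ideal[OF x] .
  interpret P: ideal "PIdl x" R by (rule P)
  let ?B = "R Quot (PIdl x)" and ?J = "quotient_image R I (PIdl x)"
  interpret B: cring ?B by (rule P.quotient_is_cring[OF is_cring])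
  have J: "ideal ?J ?B"
    using ring_ideal_imp_quot_ideal[OF P I] by (simp add: quotient_image_def)
  have "ratliff_rush_closure ?B ?J \<subseteq> ?J"
  proof
    fix C assume "C \<in> ratliff_rush_closure ?B ?J"
    then obtain j where C: "C \<in> colon ?B (ideal_pow ?B ?J (Suc j)) (ideal_pow ?B ?J j)"
      by (auto simp: ratliff_rush_closure_def)
    then have "C \<in> carrier ?B" by (simp add: colon_def)
    then obtain a where a: "a \<in> carrier R" "C = PIdl x +> a" by (auto simp: FactRing_simps)
    have "\<exists>u\<in>ideal_pow R I (Suc j). \<exists>t\<in>carrier R. a \<otimes> l = u \<oplus> x \<otimes> t" if l: "l \<in> ideal_pow R I j" for l
    proof -
      have lc: "l \<in> carrier R" using ideal_pow_carr[OF I l] .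
      have "PIdl x +> l \<in> ideal_pow ?B ?J j"
        unfolding quotient_image_ideal_pow[OF P I] using l by (simp add: quotient_image_def)
      then have "C \<otimes>\<^bsub>?B\<^esub> (PIdl x +> l) \<in> quotient_image R (ideal_pow R I (Suc j)) (PIdl x)"
        using C unfolding colon_def quotient_image_ideal_pow[OF P I] by blast
      moreover have "C \<otimes>\<^bsub>?B\<^esub> (PIdl x +> l) = PIdl x +> a \<otimes> l"
        using a lc by (simp add: FactRing_def P.rcoset_mult_add)
      ultimately obtain u where u: "u \<in> ideal_pow R I (Suc j)" "PIdl x +> a \<otimes> l = PIdl x +> u"
        by (auto simp: quotient_image_def)
      have uc: "u \<in> carrier R" using ideal_pow_carr[OF I u(1)] .
      have "a \<otimes> l \<ominus> u \<in> PIdl x"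
        using quotient_eq_iff_same_a_r_cos[OF P, of "a \<otimes> l" u] u(2) a(1) lc uc by simp
      then obtain t where t: "t \<in> carrier R" "a \<otimes> l \<ominus> u = t \<otimes> x"
        unfolding cgenideal_def by blast
      have "a \<otimes> l = u \<oplus> (a \<otimes> l \<ominus> u)" using a(1) lc uc by algebra
      also have "\<dots> = u \<oplus> x \<otimes> t" unfolding t(2) using m_comm[OF t(1) x] by simp
      finally show ?thesis using t(1) u(1) by blast
    qed
    then have "a \<in> I" using closed a(1) by blast
    then show "C \<in> ?J" using a(2) by (simp add: quotient_image_def)
  qed
  moreover have "?J \<subseteq> ratliff_rush_closure ?B ?J"
  proof
    fix C assume C: "C \<in> ?J"
    then have "C \<in> colon ?B (ideal_pow ?B ?J (Suc 0)) (ideal_pow ?B ?J 0)"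
      using ideal.I_r_closed[OF J C] ideal.Icarr[OF J C] B.ideal_pow_1[OF J] by (simp add: colon_def)
    then show "C \<in> ratliff_rush_closure ?B ?J" unfolding ratliff_rush_closure_def by blast
  qed
  ultimately show ?thesis using J by (simp add: ratliff_rush_closed_def)
qed

end

theorem proposition7p11:
  fixes A :: "('a, 'b) ring_scheme" and \<mm> I :: "'a set" and x :: 'a
  assumes "local_ring A \<mm>"
    and "noetherian_ring A"
    and "local_depth A \<mm> \<ge> 2"
    and "primary_to A \<mm> I"
    and "ratliff_rush_closed A I"
    and "\<forall>\<^sub>F n in sequentially. assoc_graded_depth A \<mm> (ideal_pow A I n) \<ge> 2"
    and "superficial A I x"
  shows "ratliff_rush_closed (A Quot (PIdl\<^bsub>A\<^esub> x)) (quotient_image A I (PIdl\<^bsub>A\<^esub> x))"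
proof -
  interpret cring A using assms(1) by (simp add: local_ring_def)
  have I: "ideal I A" using assms(5) by (simp add: ratliff_rush_closed_def)
  have M: "ideal \<mm> A" using assms(1) by (simp add: local_ring_def maximalideal_def)
  have rad: "\<mm> = ideal_radical A I" using assms(4) by (simp add: primary_to_def)
  have IM: "I \<subseteq> \<mm>"
  proof
    fix b assume "b \<in> I"
    then have "b \<in> carrier A" "b [^]\<^bsub>A\<^esub> (1::nat) \<in> I" using ideal.Icarr[OF I] by simp_all
    then show "b \<in> \<mm>" unfolding rad ideal_radical_def by blast
  qed
  obtain c where xI: "x \<in> I"
    and c: "\<forall>n\<ge>c. colon A (ideal_pow A I (Suc n)) {x} \<inter> ideal_pow A I c = ideal_pow A I n"
    using assms(7) by (auto simp: superficial_def)
  obtain N where N: "\<And>n. n \<ge> N \<Longrightarrow> assoc_graded_depth A \<mm> (ideal_pow A I n) \<ge> 2"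
    using assms(6) by (auto simp: eventually_sequentially)
  show ?thesis
  proof (rule ratliff_rush_closed_quotientI[OF I xI])
    fix a j
    assume a: "a \<in> carrier A"
      and mult: "\<forall>l\<in>ideal_pow A I j. \<exists>u\<in>ideal_pow A I (Suc j). \<exists>t\<in>carrier A. a \<otimes>\<^bsub>A\<^esub> l = u \<oplus>\<^bsub>A\<^esub> x \<otimes>\<^bsub>A\<^esub> t"
    (* Large enough for the depth hypothesis on \<open>I\<^sup>r\<close> and for dividing by \<open>x\<close> from degree one on. *)
    define r where "r = Suc (N + j + c)"
    define K where "K = ideal_pow A I r"
    have K: "ideal K A" unfolding K_def by (rule ideal_pow_ideal[OF I])
    interpret G: cring "assoc_graded A K" by (rule assoc_graded_cring[OF K])
    have "K \<subseteq> ideal_pow A I (Suc 0)" unfolding K_def by (rule ideal_pow_antimono[OF I]) (simp add: r_def)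
    then have KM: "K \<subseteq> \<mm>" using IM ideal_pow_1[OF I] by blast
    have nil: "\<exists>s::nat. b [^]\<^bsub>A\<^esub> s \<in> K" if "b \<in> \<mm>" for b
    proof -
      obtain k :: nat where k: "b \<in> carrier A" "b [^]\<^bsub>A\<^esub> k \<in> I" using \<open>b \<in> \<mm>\<close> by (auto simp: rad ideal_radical_def)
      have "b [^]\<^bsub>A\<^esub> (k * r) \<in> K"
        using elem_pow_in_ideal_pow[OF I k(2), of r] k(1) by (simp add: K_def nat_pow_pow)
      then show ?thesis by blast
    qed
    have "assoc_graded_depth A \<mm> K \<ge> 2" unfolding K_def by (rule N) (simp add: r_def)
    then obtain f g where fg: "f \<in> graded_maximal_ideal A \<mm> K" "g \<in> graded_maximal_ideal A \<mm> K"
      "regular_pair (assoc_graded A K) f g"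
      using G.regular_pair_of_grade unfolding assoc_graded_depth_def by blast
    obtain s t :: nat where st: "(f [^]\<^bsub>assoc_graded A K\<^esub> s) 0 = K" "(g [^]\<^bsub>assoc_graded A K\<^esub> t) 0 = K"
      using graded_maximal_ideal_pow[OF K M KM nil fg(1)] graded_maximal_ideal_pow[OF K M KM nil fg(2)] by blast
    then have "a \<otimes>\<^bsub>A\<^esub> p \<in> ideal_pow A I (Suc r)" if "p \<in> ideal_pow A I r" for p
      using regular_pair_removes_superficial_correction[OF I xI a c mult _
          G.regular_pair_pow[OF fg(3), unfolded K_def] st[unfolded K_def] that]
      by (simp add: r_def)
    then have "a \<in> ratliff_rush_closure A I" using a by (auto simp: ratliff_rush_closure_def colon_def)
    then show "a \<in> I" using assms(5) by (simp add: ratliff_rush_closed_def)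
  qed
qed


end
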